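(* For all positive integers $k,m,n$ with $k\ge 2$, \[ R^{cl}(\omega\cdot m+n+1,k+1) \leq R^{cl}(\omega\cdot m+1,k+1) + P^{cl}\big( (R^{cl}(\omega\cdot m+n+1,k))_{2m},\, R(n,k+1) \big), \] where the notation $((x)_{2m},y)$ is shorthand for $(x,x,\dots,x,y)$ with $x$ appearing precisely $2m$ times.
   Context: All arithmetic operations on ordinals are in the ordinal sense. Every ordinal is identified with the set of smaller ordinals and carries the order topology; subsets carry the subspace topology. A set $X$ of ordinals is order-homeomorphic to an ordinal $\alpha$ (a closed copy of $\alpha$) if there is a bijection $X\to\alpha$ that is both an order-isomorphism and a homeomorphism; equivalently, $X$ is order-isomorphic to $\alpha$ and closed in its supremum. $[X]^2$ is the set of $2$-element subsets of $X$. $R^{cl}(\alpha,k)$ (respectively $R(\alpha,k)$) is the least ordinal $\beta$ such that for every coloring $c:[\beta]^2\to\{\text{red},\text{blue}\}$ either there is $X\subseteq\beta$ order-homeomorphic (respectively order-isomorphic) to $\alpha$ with all elements of $[X]^2$ red, or there is a $k$-element $Y\subseteq\beta$ with all elements of $[Y]^2$ blue; for finite $\alpha=n$, $R(n,k)$ is the usual finite Ramsey number. $P^{cl}(\alpha_1,\dots,\alpha_r)$ is the least ordinal $\beta$ such that for every coloring $c:\beta\to\{1,\dots,r\}$ there are $i$ and $X\subseteq c^{-1}(\{i\})$ order-homeomorphic to $\alpha_i$. *)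

theory Defs
  imports "HOL-Analysis.Analysis" "HOL-Library.Ramsey" "HOL-Library.Extended"
begin

section \<open>Ordinals\<close>

text \<open>
  An ordinal is an isomorphism class of well-orders on a subset of \<open>'a + nat\<close>, so that
  \<open>'a ordinal\<close> consists of all ordinals of cardinality at most that of \<open>'a + nat\<close>.  In
  particular it contains all countable ordinals.  Since \<open>'a\<close> is arbitrary, there is no bound
  on the cardinality of the ordinals under consideration.
\<close>

quotient_type 'a ordinal =
  "('a + nat) rel" / partial: "\<lambda>r s. Well_order r \<and> Well_order s \<and> (r, s) \<in> ordIso"
proof (rule part_equivpI)
  show "\<exists>r :: ('a + nat) rel. Well_order r \<and> Well_order r \<and> (r, r) \<in> ordIso"
    by (rule exI[of _ "{}"]) (simp add: ordIso_reflexive)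
  show "symp (\<lambda>r s :: ('a + nat) rel. Well_order r \<and> Well_order s \<and> (r, s) \<in> ordIso)"
    by (blast intro: sympI ordIso_symmetric)
  show "transp (\<lambda>r s :: ('a + nat) rel. Well_order r \<and> Well_order s \<and> (r, s) \<in> ordIso)"
    by (blast intro: transpI ordIso_transitive)
qed

lemma ordinal_cases:
  obtains r where "Well_order r" "x = abs_ordinal r"
proof
  show "Well_order (rep_ordinal x)"
    using Quotient3_rep_reflp[OF Quotient3_ordinal, of x] by (rule conjunct1)
  show "x = abs_ordinal (rep_ordinal x)"
    by (rule Quotient3_abs_rep[OF Quotient3_ordinal, symmetric])
qed

instantiation ordinal :: (type) wellorder
begin

lift_definition less_eq_ordinal :: "'a ordinal \<Rightarrow> 'a ordinal \<Rightarrow> bool"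
  is "\<lambda>r s. (r, s) \<in> ordLeq"
  by (meson ordIso_symmetric ordIso_ordLeq_trans ordLeq_ordIso_trans)

lift_definition less_ordinal :: "'a ordinal \<Rightarrow> 'a ordinal \<Rightarrow> bool"
  is "\<lambda>r s. (r, s) \<in> ordLess"
  by (meson ordIso_symmetric ordIso_ordLess_trans ordLess_ordIso_trans)

instance
proof
  fix x y z :: "'a ordinal"
  obtain r s where r: "Well_order r" "x = abs_ordinal r" and s: "Well_order s" "y = abs_ordinal s"
    by (metis ordinal_cases)
  have le: "x \<le> y \<longleftrightarrow> (r, s) \<in> ordLeq" "y \<le> x \<longleftrightarrow> (s, r) \<in> ordLeq"
    using r s by (simp_all add: less_eq_ordinal.abs_eq ordIso_reflexive)
  have less: "x < y \<longleftrightarrow> (r, s) \<in> ordLess"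
    using r s by (simp add: less_ordinal.abs_eq ordIso_reflexive)
  show "(x < y) = (x \<le> y \<and> \<not> y \<le> x)"
    unfolding le less using not_ordLeq_iff_ordLess[OF r(1) s(1)] ordLess_imp_ordLeq by blast
  show "x \<le> x"
    using r by (simp add: less_eq_ordinal.abs_eq ordIso_reflexive ordLeq_reflexive)
  show "x \<le> y \<Longrightarrow> y \<le> z \<Longrightarrow> x \<le> z"
    by transfer (blast intro: ordLeq_transitive)
  show "x = y" if "x \<le> y" "y \<le> x"
  proof -
    have "(r, s) \<in> ordIso"
      using that unfolding le ordIso_iff_ordLeq by blast
    then show ?thesis
      using r s Quotient3_rel[OF Quotient3_ordinal, of r s] by (simp add: ordIso_reflexive)
  qed
  show "x \<le> y \<or> y \<le> x"
    unfolding le by (rule ordLeq_total[OF r(1) s(1)])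
next
  fix P :: "'a ordinal \<Rightarrow> bool" and a
  assume step: "\<And>x. (\<And>y. y < x \<Longrightarrow> P y) \<Longrightarrow> P x"
  have "Well_order r \<longrightarrow> P (abs_ordinal r)" for r
  proof (induction r rule: wf_induct_rule[OF wf_ordLess])
    case (1 r)
    show ?case
    proof (rule impI, rule step)
      fix y assume r: "Well_order r" and "y < abs_ordinal r"
      obtain s where s: "Well_order s" "y = abs_ordinal s"
        by (rule ordinal_cases)
      then have "(s, r) \<in> ordLess"
        using \<open>y < abs_ordinal r\<close> r by (simp add: less_ordinal.abs_eq ordIso_reflexive)
      then show "P y" using 1 s by blast
    qed
  qed
  then show "P a"
    by (metis ordinal_cases)
qed

end

text \<open>
  An ordinal \<open>\<beta>\<close> is identified with the set \<open>{..<\<beta>}\<close>.  Since this is an initial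
  segment, the order topology on \<open>\<beta>\<close> is the subspace topology of the order topology on the
  type.
\<close>

instantiation ordinal :: (type) linorder_topology
begin

definition open_ordinal :: "'a ordinal set \<Rightarrow> bool" where
  "open_ordinal = generate_topology (range (\<lambda>a. {..<a}) \<union> range (\<lambda>a. {a<..}))"

instance
  by standard (rule open_ordinal_def)

end

text \<open>
  The recursion clauses below combine the usual zero, successor and limit cases:
  \<open>\<alpha> + \<beta> = sup ({\<alpha>} \<union> {(\<alpha> + \<gamma>) + 1 | \<gamma> < \<beta>})\<close> and
  \<open>\<alpha> * \<beta> = sup {\<alpha> * \<gamma> + \<alpha> | \<gamma> < \<beta>}\<close>.
\<close>

instantiation ordinal :: (type) "{zero, one, plus, times}"
begin

definition zero_ordinal :: "'a ordinal" where
  "(0 :: 'a ordinal) = (LEAST x. True)"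

definition one_ordinal :: "'a ordinal" where
  "(1 :: 'a ordinal) = (LEAST x. 0 < x)"

function plus_ordinal :: "'a ordinal \<Rightarrow> 'a ordinal \<Rightarrow> 'a ordinal" where
  "plus_ordinal \<alpha> \<beta> = (LEAST \<delta>. \<alpha> \<le> \<delta> \<and> (\<forall>\<gamma>\<in>{..<\<beta>}. plus_ordinal \<alpha> \<gamma> < \<delta>))"
  by pat_completeness simp
termination
  by (relation "inv_image {(x, y). x < y} snd") (rule wf_inv_image[OF wf], simp)

declare plus_ordinal.simps [simp del]

function times_ordinal :: "'a ordinal \<Rightarrow> 'a ordinal \<Rightarrow> 'a ordinal" where
  "times_ordinal \<alpha> \<beta> = (LEAST \<delta>. \<forall>\<gamma>\<in>{..<\<beta>}. times_ordinal \<alpha> \<gamma> + \<alpha> \<le> \<delta>)"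
  by pat_completeness simp
termination
  by (relation "inv_image {(x, y). x < y} snd") (rule wf_inv_image[OF wf], simp)

declare times_ordinal.simps [simp del]

instance ..

end

primrec ord_of_nat :: "nat \<Rightarrow> 'a ordinal" where
  "ord_of_nat 0 = 0"
| "ord_of_nat (Suc n) = ord_of_nat n + 1"

definition omega :: "'a ordinal" (\<open>\<omega>\<close>) where
  "\<omega> = (LEAST \<alpha>. \<forall>n. ord_of_nat n < \<alpha>)"


section \<open>Closed and order copies\<close>

definition order_isomorphic_to :: "'a ordinal set \<Rightarrow> 'a ordinal \<Rightarrow> bool" where
  "order_isomorphic_to X \<alpha> \<longleftrightarrow>
    (\<exists>f. bij_betw f X {..<\<alpha>} \<and> (\<forall>x\<in>X. \<forall>y\<in>X. x \<le> y \<longleftrightarrow> f x \<le> f y))"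

definition order_homeomorphic_to :: "'a ordinal set \<Rightarrow> 'a ordinal \<Rightarrow> bool" where
  "order_homeomorphic_to X \<alpha> \<longleftrightarrow>
    (\<exists>f. bij_betw f X {..<\<alpha>} \<and> (\<forall>x\<in>X. \<forall>y\<in>X. x \<le> y \<longleftrightarrow> f x \<le> f y) \<and>
         homeomorphic_map (top_of_set X) (top_of_set {..<\<alpha>}) f)"


section \<open>Partition ordinals\<close>

datatype colour = Red | Blue

text \<open>
  The numbers below are the least ordinals with a given property, with the convention that the
  value is \<open>\<infinity>\<close> (the constructor \<open>Pinf\<close>) if there is no such ordinal.  The element
  \<open>Minf\<close> of the type \<open>extended\<close> is never a value.
\<close>

definition least_ordinal :: "('a ordinal \<Rightarrow> bool) \<Rightarrow> 'a ordinal extended" where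
  "least_ordinal P = (if \<exists>\<beta>. P \<beta> then Fin (LEAST \<beta>. P \<beta>) else Pinf)"

definition Rcl :: "'a ordinal \<Rightarrow> nat \<Rightarrow> 'a ordinal extended" where
  "Rcl \<alpha> k = least_ordinal (\<lambda>\<beta>. \<forall>c :: 'a ordinal set \<Rightarrow> colour.
     (\<exists>X\<subseteq>{..<\<beta>}. order_homeomorphic_to X \<alpha> \<and> (\<forall>e\<in>nsets X 2. c e = Red)) \<or>
     (\<exists>Y\<in>nsets {..<\<beta>} k. \<forall>e\<in>nsets Y 2. c e = Blue))"

definition Rord :: "'a ordinal \<Rightarrow> nat \<Rightarrow> 'a ordinal extended" where
  "Rord \<alpha> k = least_ordinal (\<lambda>\<beta>. \<forall>c :: 'a ordinal set \<Rightarrow> colour.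
     (\<exists>X\<subseteq>{..<\<beta>}. order_isomorphic_to X \<alpha> \<and> (\<forall>e\<in>nsets X 2. c e = Red)) \<or>
     (\<exists>Y\<in>nsets {..<\<beta>} k. \<forall>e\<in>nsets Y 2. c e = Blue))"

text \<open>
  The colours are the positions in the list of arguments.  An argument \<open>\<infinity>\<close> has no copies
  among the sets of ordinals.
\<close>

definition Pcl :: "'a ordinal extended list \<Rightarrow> 'a ordinal extended" where
  "Pcl \<alpha>s = least_ordinal (\<lambda>\<beta>. \<forall>c \<in> {..<\<beta>} \<rightarrow> {..<length \<alpha>s}.
     \<exists>i<length \<alpha>s. \<exists>\<alpha>. \<alpha>s ! i = Fin \<alpha> \<and>
       (\<exists>X\<subseteq>{x \<in> {..<\<beta>}. c x = i}. order_homeomorphic_to X \<alpha>))"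

end

theory Submission
  imports Defs
begin

text \<open>
  Write \<open>\<gamma>\<close> for the first summand on the right, \<open>\<pi>\<close> for the second, and suppose that a colouring
  of the pairs from \<open>\<gamma> + \<pi>\<close> has no blue set of size \<open>k + 1\<close>.  Then the initial segment \<open>\<gamma>\<close>
  contains a red closed copy \<open>X\<close> of \<open>\<omega> * m + 1\<close>.  Apart from its least point, \<open>X\<close> consists of
  \<open>m\<close> increasing sequences, each followed by its limit.  Attach to every vertex \<open>v\<close> of the final segment \<open>{\<gamma>..<\<gamma> + \<pi>}\<close> its
  relationship to these \<open>m\<close> sequences and these \<open>m\<close> limits.  Towards a limit this is the colour of
  one edge; towards a sequence it is a colour that \<open>v\<close> has to infinitely many of its members,
  chosen coherently: any finitely many vertices have their chosen colours simultaneously to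
  infinitely many members.  Limits along a nonprincipal ultrafilter on the indices would be such a
  choice; \<open>cluster_pattern\<close> obtains one from the compactness of a power of the two-point space,
  as a cluster point of the colour patterns of the members.

  Colour \<open>v\<close> by one of the \<open>2 * m\<close> objects to which it is blue in this sense, and by the
  last colour \<open>2 * m\<close> if there is none.  The choice of \<open>\<pi>\<close> yields one of two configurations.

  \<^item> A closed copy of \<open>Rcl (\<omega> * m + n + 1) k\<close> all of whose vertices are blue to the same object.
    Either it contains a red closed copy of \<open>\<omega> * m + n + 1\<close>, or it contains a blue set of size
    \<open>k\<close>.  The latter is finite, so that its vertices have a common blue neighbour in \<open>X\<close>, and
    adding this neighbour would give a blue set of size \<open>k + 1\<close>.

  \<^item> A copy of \<open>Rord n (k + 1)\<close> all of whose vertices are red to every object.  As there is no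
    blue set of size \<open>k + 1\<close>, it contains a red set \<open>Y\<close> of size \<open>n\<close>.  Each of the \<open>m\<close> limits is
    red to all of \<open>Y\<close>, and so are infinitely many members of each sequence.  These points form
    again a closed copy \<open>X'\<close> of \<open>\<omega> * m + 1\<close> (\<open>thin_copy\<close>), and \<open>X' \<union> Y\<close> is a red closed copy of
    \<open>\<omega> * m + 1 + n = \<omega> * m + n + 1\<close>.

  Topology is handled by the description of closed copies of \<open>\<alpha>\<close> as images of \<open>\<alpha>\<close> under
  increasing continuous maps (\<open>order_homeomorphic_to_iff\<close>).  Sums, products and \<open>\<omega>\<close> are defined
  as least upper bounds; that such bounds exist within a type that has only the ordinals below some
  cardinal is Hartogs' argument (\<open>small_bounded\<close>).
\<close>

section \<open>Bounded sets of ordinals\<close>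

definition le_on :: "'a::order set \<Rightarrow> 'a rel" where
  "le_on A = {(x, y). x \<in> A \<and> y \<in> A \<and> x \<le> y}"

lemma Field_le_on [simp]: "Field (le_on A) = A"
  by (auto simp: le_on_def Field_def)

lemma Well_order_le_on: "Well_order (le_on (A :: 'a::wellorder set))"
proof -
  have "wf (le_on A - Id)"
    by (rule wf_subset[OF wf]) (auto simp: le_on_def)
  moreover have "Linear_order (le_on A)"
    unfolding linear_order_on_def partial_order_on_def preorder_on_def
    by (auto simp: le_on_def refl_on_def trans_def antisym_def total_on_def Field_def)
  ultimately show ?thesis
    by (simp add: well_order_on_def)
qed

text \<open>
  An element of an initial segment determines a shorter initial segment, and a well-order is
  strictly longer than each of its proper initial segments.
\<close>
lemma le_on_ordLess:
  fixes T :: "'a::wellorder set"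
  assumes "x \<in> T" and "{..<x} \<subseteq> T"
  shows "(le_on {..<x}, le_on T) \<in> ordLess"
proof -
  have "le_on {..<x} = Restr (le_on T) (underS (le_on T) x)"
    using assms by (force simp: le_on_def underS_def)
  then show ?thesis
    using assms(1) underS_Restr_ordLess[OF Well_order_le_on, of T] by auto
qed

text \<open>
  The well-orders that represent ordinals live on subsets of \<open>'a + nat\<close>.  The small sets of
  ordinals are those that can be represented there, and they turn out to be the bounded ones.
\<close>
abbreviation small :: "'a ordinal set \<Rightarrow> bool" where
  "small A \<equiv> (card_of A, card_of (UNIV :: ('a + nat) set)) \<in> ordLeq"

text \<open>
  If \<open>r\<close> represents \<open>x\<close>, then the ordinals below \<open>x\<close> are represented by the proper initial
  segments of \<open>r\<close>, and these are indexed by the underlying set of \<open>'a + nat\<close>.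
\<close>
lemma small_lessThan: "small {..<(x :: 'a ordinal)}"
proof -
  obtain r where r: "Well_order r" "x = abs_ordinal r"
    by (rule ordinal_cases)
  let ?h = "\<lambda>a. abs_ordinal (Restr r (underS r a))"
  have "{..<x} \<subseteq> range ?h"
  proof
    fix y assume "y \<in> {..<x}"
    obtain s where s: "Well_order s" "y = abs_ordinal s"
      by (rule ordinal_cases)
    have "(s, r) \<in> ordLess"
      using \<open>y \<in> {..<x}\<close> r s by (simp add: less_ordinal.abs_eq ordIso_reflexive)
    then obtain a where "(s, Restr r (underS r a)) \<in> ordIso"
      using ordLess_iff_ordIso_Restr[OF r(1) s(1)] by blast
    then have "y = ?h a"
      using s Quotient3_rel[OF Quotient3_ordinal, of s "Restr r (underS r a)"] Well_order_Restr[OF r(1)]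
      by (auto simp add: ordIso_reflexive)
    then show "y \<in> range ?h" by blast
  qed
  then show ?thesis
    by (rule ordLeq_transitive[OF card_of_mono1 card_of_image])
qed

lemma small_UN:
  fixes A :: "'a ordinal set" and f :: "'a ordinal \<Rightarrow> 'a ordinal set"
  assumes "small A" and "\<And>x. x \<in> A \<Longrightarrow> small (f x)"
  shows "small (\<Union>x\<in>A. f x)"
  by (rule card_of_UNION_ordLeq_infinite) (use assms in \<open>auto simp: finite_Plus_UNIV_iff\<close>)

lemma small_countable:
  fixes A :: "'a ordinal set"
  assumes "countable A"
  shows "small A"
proof -
  obtain f :: "'a ordinal \<Rightarrow> nat" where "inj_on f A"
    using assms by (auto simp: countable_def)
  then show ?thesis
    by (intro card_of_ordLeqI[of "Inr \<circ> f"]) (auto intro: comp_inj_on)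
qed

text \<open>
  Hartogs' argument: a small initial segment \<open>T\<close> is carried by an injection to a well-order on
  \<open>'a + nat\<close>, hence is represented by an ordinal \<open>\<delta>\<close>.  Each \<open>x\<close> in \<open>T\<close> is at most the ordinal
  that represents \<open>{..<x}\<close>, because an increasing map on an initial segment never decreases, and
  this ordinal is below \<open>\<delta>\<close>.
\<close>
lemma initial_bounded:
  fixes T :: "'a ordinal set"
  assumes "small T" and init: "\<And>x. x \<in> T \<Longrightarrow> {..<x} \<subseteq> T"
  obtains \<delta> where "\<And>x. x \<in> T \<Longrightarrow> x < \<delta>"
proof -
  obtain j :: "'a ordinal \<Rightarrow> 'a + nat" where j: "inj_on j T"
    using assms(1) by (auto simp: card_of_ordLeq[symmetric])
  let ?R = "\<lambda>A. dir_image (le_on A) j"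
  have wo: "Well_order (?R A)" and iso: "(le_on A, ?R A) \<in> ordIso" if "A \<subseteq> T" for A
    using that inj_on_subset[OF j that] Well_order_dir_image[OF Well_order_le_on]
      dir_image_ordIso[OF Well_order_le_on] by simp_all
  have mono: "abs_ordinal (?R {..<x}) < abs_ordinal (?R A)"
    if "x \<in> A" "{..<x} \<subseteq> A" "A \<subseteq> T" for x A
  proof -
    have "(?R {..<x}, ?R A) \<in> ordLess"
      using ordLess_ordIso_trans[OF ordIso_ordLess_trans[OF ordIso_symmetric[OF iso] le_on_ordLess] iso]
        that by blast
    then show ?thesis
      using wo[of A] wo[of "{..<x}"] that by (simp add: less_ordinal.abs_eq ordIso_reflexive)
  qed
  have ge: "x \<le> abs_ordinal (?R {..<x})" if "x \<in> T" for x
    using that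
  proof (induction x rule: less_induct)
    case (less x)
    show ?case
    proof (rule ccontr)
      assume *: "\<not> ?thesis"
      define y where "y = abs_ordinal (?R {..<x})"
      have "y < x" using * by (simp add: y_def)
      have "y \<in> T" using init less.prems \<open>y < x\<close> by blast
      have "abs_ordinal (?R {..<y}) < y"
        using mono[of y "{..<x}"] \<open>y < x\<close> init[OF less.prems] by (auto simp: y_def[symmetric])
      then show False
        using less.IH[OF \<open>y < x\<close> \<open>y \<in> T\<close>] by simp
    qed
  qed
  show thesis
    using le_less_trans[OF ge mono[of _ T]] init by (intro that[of "abs_ordinal (?R T)"]) blast
qed

lemma ex_greater: "\<exists>y. (x :: 'a ordinal) < y"
proof -
  have "small {..x}"
  proof -
    have "{..x} = {..<x} \<union> {x}" by auto
    moreover have "small ({..<x} \<union> {x})"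
      by (rule card_of_Un_ordLeq_infinite_Field)
        (auto simp: finite_Plus_UNIV_iff Field_card_of card_of_card_order_on small_lessThan small_countable)
    ultimately show ?thesis by simp
  qed
  then show ?thesis
    using initial_bounded[of "{..x}"]
    by (metis Un_upper1 atMost_iff atMost_subset_iff ivl_disj_un_singleton(2) order_refl subset_trans)
qed

text \<open>
  The union of the segments \<open>{..<a}\<close> for \<open>a\<close> in \<open>A\<close> is a small initial segment; if \<open>\<epsilon>\<close> is
  greater than all elements of this union, then no member of \<open>A\<close> exceeds \<open>\<epsilon>\<close>.
\<close>
lemma small_bounded:
  fixes A :: "'a ordinal set"
  assumes "small A"
  obtains \<delta> where "\<And>x. x \<in> A \<Longrightarrow> x < \<delta>"
proof -
  obtain \<epsilon> where \<epsilon>: "x < \<epsilon>" if "x \<in> (\<Union>a\<in>A. {..<a})" for x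
  proof (rule initial_bounded[OF small_UN[OF assms small_lessThan]])
    show "{..<x} \<subseteq> (\<Union>a\<in>A. {..<a})" if "x \<in> (\<Union>a\<in>A. {..<a})" for x
      using that by fastforce
  qed (use that in blast)
  obtain \<delta> where "\<epsilon> < \<delta>" using ex_greater by blast
  have "x \<le> \<epsilon>" if "x \<in> A" for x
    using \<epsilon> that by (meson UN_I lessThan_iff less_irrefl not_le)
  then show thesis using \<open>\<epsilon> < \<delta>\<close> that by (meson le_less_trans)
qed

section \<open>Ordinal arithmetic\<close>

lemma zero_ordinal_le [simp]: "(0 :: 'a ordinal) \<le> x"
  by (simp add: zero_ordinal_def Least_le)

lemma not_less_zero_ordinal [simp]: "\<not> x < (0 :: 'a ordinal)"
  by (simp add: not_less)

lemma less_one_ordinal [simp]: "(x :: 'a ordinal) < 1 \<longleftrightarrow> x = 0"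
proof
  show "x < 1 \<Longrightarrow> x = 0"
    unfolding one_ordinal_def using not_less_Least[of x "\<lambda>x. 0 < x"] by (metis antisym_conv3 not_less_zero_ordinal)
  have "(0 :: 'a ordinal) < 1"
    unfolding one_ordinal_def by (rule LeastI_ex[OF ex_greater])
  then show "x = 0 \<Longrightarrow> x < 1" by simp
qed

lemma small_image_lessThan_bounded:
  fixes f :: "'a ordinal \<Rightarrow> 'a ordinal"
  obtains \<delta> where "\<And>\<gamma>. \<gamma> < \<beta> \<Longrightarrow> f \<gamma> < \<delta>"
proof (rule small_bounded[OF ordLeq_transitive[OF card_of_image small_lessThan[of \<beta>]], of f])
  fix \<delta> assume "\<And>x. x \<in> f ` {..<\<beta>} \<Longrightarrow> x < \<delta>"
  then show thesis by (intro that) blast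
qed

text \<open>
  The least ordinal in the definition of the sum exists because the values to be bounded form
  a small set.  All further properties of the sum follow from this lemma and \<open>add_least\<close>.
\<close>
lemma add_spec:
  fixes \<alpha> \<beta> :: "'a ordinal"
  shows "\<alpha> \<le> \<alpha> + \<beta> \<and> (\<forall>\<gamma>\<in>{..<\<beta>}. \<alpha> + \<gamma> < \<alpha> + \<beta>)"
proof -
  obtain \<delta> where "\<And>\<gamma>. \<gamma> < \<beta> \<Longrightarrow> \<alpha> + \<gamma> < \<delta>"
    using small_image_lessThan_bounded[of \<beta> "\<lambda>\<gamma>. \<alpha> + \<gamma>"] by blast
  then have "\<alpha> \<le> max \<alpha> \<delta> \<and> (\<forall>\<gamma>\<in>{..<\<beta>}. \<alpha> + \<gamma> < max \<alpha> \<delta>)"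
    by (auto simp: less_max_iff_disj)
  then show ?thesis
    unfolding plus_ordinal.simps[of \<alpha> \<beta>] by (rule LeastI)
qed

lemma le_add_left [simp]: "(\<alpha> :: 'a ordinal) \<le> \<alpha> + \<beta>"
  using add_spec by blast

lemma add_least:
  fixes \<alpha> \<beta> \<delta> :: "'a ordinal"
  assumes "\<alpha> \<le> \<delta>" and "\<And>\<gamma>. \<gamma> < \<beta> \<Longrightarrow> \<alpha> + \<gamma> < \<delta>"
  shows "\<alpha> + \<beta> \<le> \<delta>"
  unfolding plus_ordinal.simps[of \<alpha> \<beta>] by (rule Least_le) (use assms in auto)

lemma add_less_cancel [simp]: "(\<alpha> :: 'a ordinal) + \<beta> < \<alpha> + \<gamma> \<longleftrightarrow> \<beta> < \<gamma>"
  by (metis add_spec lessThan_iff less_asym' linorder_neqE)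

lemma add_le_cancel [simp]: "(\<alpha> :: 'a ordinal) + \<beta> \<le> \<alpha> + \<gamma> \<longleftrightarrow> \<beta> \<le> \<gamma>"
  by (simp flip: not_less)

lemma add_eq_cancel [simp]: "(\<alpha> :: 'a ordinal) + \<beta> = \<alpha> + \<gamma> \<longleftrightarrow> \<beta> = \<gamma>"
  by (simp add: order_eq_iff)

lemma add_zero [simp]: "(\<alpha> :: 'a ordinal) + 0 = \<alpha>"
  by (rule antisym) (auto intro: add_least)

lemma less_add_one [simp]: "x < (\<alpha> :: 'a ordinal) + 1 \<longleftrightarrow> x \<le> \<alpha>"
proof
  show "x \<le> \<alpha> \<Longrightarrow> x < \<alpha> + 1"
    using add_less_cancel[of \<alpha> 0 1] by (simp del: add_less_cancel)
  show "x < \<alpha> + 1 \<Longrightarrow> x \<le> \<alpha>"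
    using add_least[of \<alpha> x 1] by (force simp flip: not_less)
qed

lemma le_add_right [simp]: "(\<beta> :: 'a ordinal) \<le> \<alpha> + \<beta>"
proof (induction \<beta> rule: less_induct)
  case (less \<beta>)
  show ?case
  proof (rule ccontr)
    assume "\<not> \<beta> \<le> \<alpha> + \<beta>"
    then show False
      using less[of "\<alpha> + \<beta>"] by (metis add_less_cancel not_le)
  qed
qed

text \<open>
  Left subtraction: \<open>\<gamma>\<close> is least such that \<open>\<alpha> + \<gamma>\<close> reaches \<open>\<delta>\<close>, and it cannot overshoot since
  all earlier sums are below \<open>\<delta>\<close>.
\<close>
lemma le_imp_add:
  fixes \<alpha> \<delta> :: "'a ordinal"
  assumes "\<alpha> \<le> \<delta>"
  obtains \<gamma> where "\<delta> = \<alpha> + \<gamma>"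
proof
  define \<gamma> where "\<gamma> = (LEAST \<gamma>. \<delta> \<le> \<alpha> + \<gamma>)"
  have "\<delta> \<le> \<alpha> + \<gamma>"
    unfolding \<gamma>_def by (rule LeastI[of _ \<delta>]) simp
  moreover have "\<alpha> + \<gamma> \<le> \<delta>"
    using assms by (rule add_least) (use not_less_Least in \<open>force simp: \<gamma>_def\<close>)
  ultimately show "\<delta> = \<alpha> + \<gamma>" by simp
qed

lemma ordinal_add_assoc: "(\<alpha> :: 'a ordinal) + \<beta> + \<gamma> = \<alpha> + (\<beta> + \<gamma>)"
proof (induction \<gamma> rule: less_induct)
  case (less \<gamma>)
  show ?case
  proof (rule antisym)
    show "\<alpha> + \<beta> + \<gamma> \<le> \<alpha> + (\<beta> + \<gamma>)"
      by (rule add_least) (simp_all add: less)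
    show "\<alpha> + (\<beta> + \<gamma>) \<le> \<alpha> + \<beta> + \<gamma>"
    proof (rule add_least)
      show "\<alpha> \<le> \<alpha> + \<beta> + \<gamma>"
        using le_add_left[of \<alpha> \<beta>] le_add_left[of "\<alpha> + \<beta>" \<gamma>] by (rule order_trans)
      fix \<delta> assume \<delta>: "\<delta> < \<beta> + \<gamma>"
      show "\<alpha> + \<delta> < \<alpha> + \<beta> + \<gamma>"
      proof (cases "\<delta> < \<beta>")
        case True
        then have "\<alpha> + \<delta> < \<alpha> + \<beta>" by simp
        then show ?thesis using le_add_left less_le_trans by blast
      next
        case False
        then obtain \<epsilon> where "\<delta> = \<beta> + \<epsilon>"
          using le_imp_add[of \<beta> \<delta>] by (metis not_less)
        then show ?thesis using \<delta> less[of \<epsilon>] by (metis add_less_cancel)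
      qed
    qed
  qed
qed

lemma times_spec:
  fixes \<alpha> \<beta> :: "'a ordinal"
  shows "\<forall>\<gamma>\<in>{..<\<beta>}. \<alpha> * \<gamma> + \<alpha> \<le> \<alpha> * \<beta>"
proof -
  obtain \<delta> where "\<And>\<gamma>. \<gamma> < \<beta> \<Longrightarrow> \<alpha> * \<gamma> + \<alpha> < \<delta>"
    using small_image_lessThan_bounded[of \<beta> "\<lambda>\<gamma>. \<alpha> * \<gamma> + \<alpha>"] by blast
  then have "\<forall>\<gamma>\<in>{..<\<beta>}. \<alpha> * \<gamma> + \<alpha> \<le> \<delta>"
    by (auto intro: less_imp_le)
  then show ?thesis
    unfolding times_ordinal.simps[of \<alpha> \<beta>] by (rule LeastI)
qed

lemma times_least:
  fixes \<alpha> \<beta> \<delta> :: "'a ordinal"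
  assumes "\<And>\<gamma>. \<gamma> < \<beta> \<Longrightarrow> \<alpha> * \<gamma> + \<alpha> \<le> \<delta>"
  shows "\<alpha> * \<beta> \<le> \<delta>"
  unfolding times_ordinal.simps[of \<alpha> \<beta>] by (rule Least_le) (use assms in auto)

lemma times_zero [simp]: "(\<alpha> :: 'a ordinal) * 0 = 0"
  by (rule antisym) (auto intro: times_least)

lemma times_add_one: "(\<alpha> :: 'a ordinal) * (\<beta> + 1) = \<alpha> * \<beta> + \<alpha>"
proof (rule antisym)
  show "\<alpha> * \<beta> + \<alpha> \<le> \<alpha> * (\<beta> + 1)"
    using times_spec[of "\<beta> + 1" \<alpha>] by simp
  show "\<alpha> * (\<beta> + 1) \<le> \<alpha> * \<beta> + \<alpha>"
  proof (rule times_least)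
    fix \<gamma> assume "\<gamma> < \<beta> + 1"
    then consider "\<gamma> = \<beta>" | "\<gamma> < \<beta>" by (auto simp: le_less)
    then show "\<alpha> * \<gamma> + \<alpha> \<le> \<alpha> * \<beta> + \<alpha>"
    proof cases
      case 2
      then have "\<alpha> * \<gamma> + \<alpha> \<le> \<alpha> * \<beta>" using times_spec by blast
      then show ?thesis using le_add_left order_trans by blast
    qed simp
  qed
qed

lemma times_mono_right: "\<beta> \<le> \<gamma> \<Longrightarrow> (\<alpha> :: 'a ordinal) * \<beta> \<le> \<alpha> * \<gamma>"
  using times_spec[of \<gamma> \<alpha>] le_add_left[of "\<alpha> * \<beta>" \<alpha>] by (force simp: le_less intro: order_trans)

lemma less_ord_of_nat_iff: "x < ord_of_nat n \<longleftrightarrow> (\<exists>j<n. x = ord_of_nat j)"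
  by (induction n) (auto simp: le_less less_Suc_eq)

lemma ord_of_nat_less_iff [simp]: "ord_of_nat i < (ord_of_nat j :: 'a ordinal) \<longleftrightarrow> i < j"
proof -
  have *: "ord_of_nat i < (ord_of_nat j :: 'a ordinal)" if "i < j" for i j
    using that by (auto simp: less_ord_of_nat_iff)
  show ?thesis
    using *[of i j] *[of j i] by (metis less_asym linorder_neqE)
qed

lemma ord_of_nat_le_iff [simp]: "ord_of_nat i \<le> (ord_of_nat j :: 'a ordinal) \<longleftrightarrow> i \<le> j"
  by (simp flip: not_less)

lemma inj_ord_of_nat: "inj ord_of_nat"
  by (rule injI) (metis linorder_neqE_nat ord_of_nat_less_iff less_irrefl)

lemma lessThan_ord_of_nat: "{..<ord_of_nat n} = ord_of_nat ` {..<n}"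
  by (auto simp: less_ord_of_nat_iff)

lemma one_add_ord_of_nat: "1 + ord_of_nat n = (ord_of_nat n + 1 :: 'a ordinal)"
proof (induction n)
  case 0
  have "(0 :: 'a ordinal) + 1 = 1"
    by (rule antisym) (auto intro: add_least)
  then show ?case by simp
next
  case (Suc n)
  then show ?case by (simp flip: ordinal_add_assoc)
qed

lemma ord_of_nat_less_omega [simp]: "ord_of_nat n < \<omega>"
proof -
  have "\<exists>\<alpha> :: 'a ordinal. \<forall>n. ord_of_nat n < \<alpha>"
    using small_bounded[OF small_countable[of "range ord_of_nat"]] by (metis countable_image countableI_type rangeI)
  from LeastI_ex[OF this] show ?thesis by (simp add: omega_def)
qed

lemma less_omega_iff: "x < \<omega> \<longleftrightarrow> (\<exists>n. x = ord_of_nat n)"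
proof
  assume x: "x < \<omega>"
  show "\<exists>n. x = ord_of_nat n"
  proof (rule ccontr)
    assume no: "\<nexists>n. x = ord_of_nat n"
    have "ord_of_nat n < x" for n
      by (metis no less_ord_of_nat_iff linorder_neqE)
    then have "\<omega> \<le> x"
      unfolding omega_def by (intro Least_le) blast
    with x show False by simp
  qed
qed auto

lemma one_add_omega: "1 + \<omega> = (\<omega> :: 'a ordinal)"
proof (rule antisym)
  show "1 + \<omega> \<le> (\<omega> :: 'a ordinal)"
  proof (rule add_least)
    have "ord_of_nat 1 < (\<omega> :: 'a ordinal)" by (rule ord_of_nat_less_omega)
    then show "1 \<le> (\<omega> :: 'a ordinal)"
      using one_add_ord_of_nat[of 0, where 'a = 'a] by simp
    fix \<gamma> :: "'a ordinal" assume "\<gamma> < \<omega>"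
    then show "1 + \<gamma> < \<omega>"
      by (metis less_omega_iff one_add_ord_of_nat ord_of_nat.simps(2))
  qed
qed simp

lemma tendsto_add_omega: "(\<lambda>j. \<alpha> + ord_of_nat j) \<longlonglongrightarrow> (\<alpha> + \<omega> :: 'a ordinal)"
proof (rule order_tendstoI)
  fix y :: "'a ordinal" assume y: "y < \<alpha> + \<omega>"
  have "\<exists>n. y < \<alpha> + ord_of_nat n"
  proof (rule ccontr)
    assume *: "\<nexists>n. y < \<alpha> + ord_of_nat n"
    have "\<alpha> + \<omega> \<le> y"
    proof (rule add_least)
      show "\<alpha> \<le> y" using * by (metis add_zero not_less ord_of_nat.simps(1))
      fix \<gamma> :: "'a ordinal" assume "\<gamma> < \<omega>"
      then obtain n where "\<gamma> = ord_of_nat n" by (auto simp: less_omega_iff)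
      then have "\<alpha> + \<gamma> < \<alpha> + ord_of_nat (Suc n)" by simp
      also have "\<dots> \<le> y" using * by (metis not_less)
      finally show "\<alpha> + \<gamma> < y" .
    qed
    with y show False by simp
  qed
  then obtain n where n: "y < \<alpha> + ord_of_nat n" ..
  have "y < \<alpha> + ord_of_nat j" if "n \<le> j" for j
    using n that by (metis add_le_cancel less_le_trans ord_of_nat_le_iff)
  then show "\<forall>\<^sub>F j in sequentially. y < \<alpha> + ord_of_nat j"
    by (auto simp: eventually_sequentially)
next
  fix y :: "'a ordinal" assume "\<alpha> + \<omega> < y"
  then have "\<alpha> + ord_of_nat j < y" for j
    using add_less_cancel[of \<alpha> "ord_of_nat j" \<omega>] by (metis less_trans ord_of_nat_less_omega)
  then show "\<forall>\<^sub>F j in sequentially. \<alpha> + ord_of_nat j < y"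
    by simp
qed

section \<open>Closed copies as images of increasing continuous maps\<close>

text \<open>
  At every point, an increasing map on an ordinal is continuous from above, because
  \<open>{..x}\<close> is open.  So only the approach from below has to be checked, and only at points other than
  the first.
\<close>
lemma strict_mono_continuous:
  fixes g :: "'a ordinal \<Rightarrow> 'a ordinal"
  assumes mono: "strict_mono_on {..<\<alpha>} g"
    and sup: "\<And>x y. x < \<alpha> \<Longrightarrow> y < g x \<Longrightarrow> x = 0 \<or> (\<exists>z<x. \<forall>w. z < w \<longrightarrow> w \<le> x \<longrightarrow> y < g w)"
  shows "continuous_on {..<\<alpha>} g"
  unfolding continuous_on_def
proof
  fix x assume x: "x \<in> {..<\<alpha>}"
  have le: "g v \<le> g w" if "v \<le> w" "w < \<alpha>" for v w
    using that strict_mono_onD[OF mono, of v w] by (auto simp: le_less)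
  show "(g \<longlongrightarrow> g x) (at x within {..<\<alpha>})"
  proof (rule order_tendstoI)
    fix y assume y: "y < g x"
    show "\<forall>\<^sub>F w in at x within {..<\<alpha>}. y < g w"
    proof (cases "x = 0")
      case True
      have "y < g w" if "w < \<alpha>" for w
        using y le[of x w] that True by auto
      then show ?thesis by (auto simp: eventually_at_topological intro: exI[of _ UNIV])
    next
      case False
      then obtain z where z: "z < x" "\<And>w. z < w \<Longrightarrow> w \<le> x \<Longrightarrow> y < g w"
        using sup x y by blast
      have "y < g w" if "w < \<alpha>" "z < w" for w
        using that z(2)[of w] y le[of x w] by (cases "w \<le> x") (auto intro: less_le_trans)
      then show ?thesis
        using z(1) by (auto simp: eventually_at_topological intro!: exI[of _ "{z<..}"])
    qed
  next
    fix y assume y: "g x < y"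
    have "g w < y" if "w < x + 1" for w
      using that y le[of w x] x by auto
    then show "\<forall>\<^sub>F w in at x within {..<\<alpha>}. g w < y"
      by (auto simp: eventually_at_topological intro!: exI[of _ "{..<x + 1}"])
  qed
qed

text \<open>
  The topology of a subspace refines its order topology, and
  preimages of rays under the inverse map are traces of rays.
\<close>
lemma strict_mono_inverse_continuous:
  fixes g :: "'a ordinal \<Rightarrow> 'a ordinal"
  assumes mono: "strict_mono_on {..<\<alpha>} g"
    and inv: "\<And>x. x < \<alpha> \<Longrightarrow> f (g x) = x"
  shows "continuous_on (g ` {..<\<alpha>}) f"
  unfolding continuous_on_def
proof clarsimp
  fix x assume x: "x < \<alpha>"
  have less: "v < w \<longleftrightarrow> g v < g w" if "v < \<alpha>" "w < \<alpha>" for v w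
    using that strict_mono_onD[OF mono, of v w] strict_mono_onD[OF mono, of w v]
    by (metis lessThan_iff less_asym linorder_neqE)
  show "(f \<longlongrightarrow> f (g x)) (at (g x) within g ` {..<\<alpha>})"
  proof (rule order_tendstoI)
    fix y assume "y < f (g x)"
    then have y: "y < x" using inv x by simp
    then show "\<forall>\<^sub>F w in at (g x) within g ` {..<\<alpha>}. y < f w"
      using x y less[of y] less_trans[OF y x] inv by (auto simp: eventually_at_topological intro!: exI[of _ "{g y<..}"])
  next
    fix y assume "f (g x) < y"
    then have y: "x < y" using inv x by simp
    show "\<forall>\<^sub>F w in at (g x) within g ` {..<\<alpha>}. f w < y"
    proof (cases "y < \<alpha>")
      case True
      then show ?thesis
        using x y less inv by (auto simp: eventually_at_topological intro!: exI[of _ "{..<g y}"])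
    next
      case False
      then show ?thesis
        using inv by (auto simp: eventually_at_topological intro!: exI[of _ UNIV])
    qed
  qed
qed

text \<open>
  This is the form in which closed copies are used below: compositions, restrictions and
  concatenations of increasing continuous maps are easy to form, and the inverse map is continuous
  by \<open>strict_mono_inverse_continuous\<close>.
\<close>
lemma order_homeomorphic_to_iff:
  "order_homeomorphic_to X \<alpha> \<longleftrightarrow>
    (\<exists>g. strict_mono_on {..<\<alpha>} g \<and> continuous_on {..<\<alpha>} g \<and> X = g ` {..<\<alpha>})"
proof
  assume "order_homeomorphic_to X \<alpha>"
  then obtain f where f: "bij_betw f X {..<\<alpha>}" "\<And>x y. x \<in> X \<Longrightarrow> y \<in> X \<Longrightarrow> x \<le> y \<longleftrightarrow> f x \<le> f y"
    "homeomorphic_map (top_of_set X) (top_of_set {..<\<alpha>}) f"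
    unfolding order_homeomorphic_to_def by blast
  obtain g where g: "homeomorphic_maps (top_of_set X) (top_of_set {..<\<alpha>}) f g"
    using f(3) homeomorphic_map_maps by blast
  have gX: "g x \<in> X" and fg: "f (g x) = x" if "x < \<alpha>" for x
    using g that by (auto simp: homeomorphic_maps_def continuous_map_def Pi_iff)
  have gf: "g (f x) = x" if "x \<in> X" for x
    using g that by (auto simp: homeomorphic_maps_def)
  have "strict_mono_on {..<\<alpha>} g"
    by (rule strict_mono_onI) (metis fg gX f(2) lessThan_iff not_le)
  moreover have "continuous_on {..<\<alpha>} g"
    using g by (auto simp: homeomorphic_maps_def continuous_map_in_subtopology)
  moreover have "X = g ` {..<\<alpha>}"
    using gX gf bij_betwE[OF f(1)] by (force simp: image_iff)
  ultimately show "\<exists>g. strict_mono_on {..<\<alpha>} g \<and> continuous_on {..<\<alpha>} g \<and> X = g ` {..<\<alpha>}"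
    by blast
next
  assume "\<exists>g. strict_mono_on {..<\<alpha>} g \<and> continuous_on {..<\<alpha>} g \<and> X = g ` {..<\<alpha>}"
  then obtain g where g: "strict_mono_on {..<\<alpha>} g" "continuous_on {..<\<alpha>} g" "X = g ` {..<\<alpha>}"
    by blast
  have inj: "inj_on g {..<\<alpha>}"
    using g(1) by (rule strict_mono_on_imp_inj_on)
  define f where "f = inv_into {..<\<alpha>} g"
  have fg: "f (g x) = x" if "x < \<alpha>" for x
    using inj that by (simp add: f_def)
  have "continuous_on X f"
    unfolding g(3) using g(1) fg by (rule strict_mono_inverse_continuous)
  then have "homeomorphic_maps (top_of_set X) (top_of_set {..<\<alpha>}) f g"
    using g(2) fg unfolding g(3)
    by (auto simp: homeomorphic_maps_def continuous_map_in_subtopology)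
  then have "homeomorphic_map (top_of_set X) (top_of_set {..<\<alpha>}) f"
    using homeomorphic_map_maps by blast
  moreover have "bij_betw f X {..<\<alpha>}"
    unfolding f_def g(3) by (rule inj_on_imp_bij_betw[THEN bij_betw_inv_into, OF inj])
  moreover have "\<forall>x\<in>X. \<forall>y\<in>X. x \<le> y \<longleftrightarrow> f x \<le> f y"
    using strict_mono_on_less_eq[OF g(1)] fg by (auto simp: g(3))
  ultimately show "order_homeomorphic_to X \<alpha>"
    unfolding order_homeomorphic_to_def by blast
qed

lemma order_homeomorphic_toI:
  "strict_mono_on {..<\<alpha>} g \<Longrightarrow> continuous_on {..<\<alpha>} g \<Longrightarrow> order_homeomorphic_to (g ` {..<\<alpha>}) \<alpha>"
  by (auto simp: order_homeomorphic_to_iff)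

lemma order_homeomorphic_to_lessThan: "order_homeomorphic_to {..<\<alpha>} \<alpha>"
  using order_homeomorphic_toI[of \<alpha> "\<lambda>x. x"] by (simp add: strict_mono_on_def)

lemma order_homeomorphic_to_image:
  assumes X: "order_homeomorphic_to X \<alpha>" "X \<subseteq> {..<\<beta>}"
    and h: "strict_mono_on {..<\<beta>} h" "continuous_on {..<\<beta>} h"
  shows "order_homeomorphic_to (h ` X) \<alpha>"
proof -
  obtain g where g: "strict_mono_on {..<\<alpha>} g" "continuous_on {..<\<alpha>} g" "X = g ` {..<\<alpha>}"
    using X(1) by (auto simp: order_homeomorphic_to_iff)
  have "strict_mono_on {..<\<alpha>} (h \<circ> g)"
    using X(2) unfolding g(3)
    by (intro strict_mono_onI) (auto intro!: strict_mono_onD[OF h(1)] strict_mono_onD[OF g(1)])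
  moreover have "continuous_on {..<\<alpha>} (h \<circ> g)"
    using g X(2) h(2) continuous_on_compose continuous_on_subset by blast
  ultimately show ?thesis
    using order_homeomorphic_toI[of \<alpha> "h \<circ> g"] by (simp add: g(3) image_comp)
qed

text \<open>
  A finite space in which points are closed is discrete.
\<close>
lemma order_homeomorphic_to_finite:
  assumes "order_isomorphic_to X \<alpha>" and "finite {..<\<alpha>}"
  shows "order_homeomorphic_to X \<alpha>"
proof -
  obtain f where f: "bij_betw f X {..<\<alpha>}" "\<And>x y. x \<in> X \<Longrightarrow> y \<in> X \<Longrightarrow> x \<le> y \<longleftrightarrow> f x \<le> f y"
    using assms(1) unfolding order_isomorphic_to_def by blast
  define g where "g = inv_into X f"
  have g: "bij_betw g {..<\<alpha>} X" "\<And>x. x < \<alpha> \<Longrightarrow> f (g x) = x"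
    using f(1) by (auto simp: g_def bij_betw_inv_into bij_betw_inv_into_right)
  have "strict_mono_on {..<\<alpha>} g"
    by (rule strict_mono_onI) (metis g f(2) bij_betwE lessThan_iff not_le)
  then show ?thesis
    using order_homeomorphic_toI[OF _ continuous_on_finite[OF assms(2)], of g] g(1)
    by (simp add: bij_betw_def)
qed

lemma continuous_on_add: "continuous_on {..<\<beta>} (\<lambda>\<gamma>. \<alpha> + \<gamma> :: 'a ordinal)"
proof (rule strict_mono_continuous)
  fix x y :: "'a ordinal"
  assume "y < \<alpha> + x"
  show "x = 0 \<or> (\<exists>z<x. \<forall>w. z < w \<longrightarrow> w \<le> x \<longrightarrow> y < \<alpha> + w)"
  proof (cases "y < \<alpha>")
    case True
    then show ?thesis
      by (metis le_add_left less_le_trans zero_ordinal_le le_less)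
  next
    case False
    then obtain z where "y = \<alpha> + z"
      using le_imp_add[of \<alpha> y] by (metis not_less)
    then show ?thesis using \<open>y < \<alpha> + x\<close> by auto
  qed
qed (simp add: strict_mono_on_def)

lemma image_add_lessThan: "(\<lambda>\<gamma>. \<alpha> + \<gamma>) ` {..<\<beta>} = {\<alpha>..<\<alpha> + \<beta> :: 'a ordinal}"
  by (force elim: le_imp_add)

lemma order_homeomorphic_to_interval: "order_homeomorphic_to {\<alpha>..<\<alpha> + \<beta>} (\<beta> :: 'a ordinal)"
  using order_homeomorphic_toI[OF _ continuous_on_add, of \<beta> \<alpha>]
  by (simp add: image_add_lessThan strict_mono_on_def)

text \<open>
  The first order type is a successor, so that the part below \<open>\<alpha> + 1\<close> and the rest are both
  open in \<open>\<alpha> + 1 + \<beta>\<close>, and continuity can be checked on each of them.  After a limit ordinal the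
  statement would fail, as the first point of \<open>Y\<close> need not be the supremum of \<open>X\<close>.
\<close>
lemma order_homeomorphic_to_Un:
  fixes \<alpha> \<beta> :: "'a ordinal"
  assumes X: "order_homeomorphic_to X (\<alpha> + 1)" and Y: "order_homeomorphic_to Y \<beta>"
    and XY: "\<And>x y. x \<in> X \<Longrightarrow> y \<in> Y \<Longrightarrow> x < y"
  shows "order_homeomorphic_to (X \<union> Y) (\<alpha> + 1 + \<beta>)"
proof -
  let ?\<sigma> = "\<alpha> + 1"
  obtain g where g: "strict_mono_on {..<?\<sigma>} g" "continuous_on {..<?\<sigma>} g" "X = g ` {..<?\<sigma>}"
    using X by (auto simp only: order_homeomorphic_to_iff)
  obtain h where h: "strict_mono_on {..<\<beta>} h" "continuous_on {..<\<beta>} h" "Y = h ` {..<\<beta>}"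
    using Y by (auto simp: order_homeomorphic_to_iff)
  define s where "s \<delta> = (THE \<gamma>. \<delta> = ?\<sigma> + \<gamma>)" for \<delta>
  have s [simp]: "s (?\<sigma> + \<gamma>) = \<gamma>" for \<gamma>
    by (simp add: s_def)
  define e where "e \<delta> = (if \<delta> < ?\<sigma> then g \<delta> else h (s \<delta>))" for \<delta>
  have e1: "e \<delta> = g \<delta>" if "\<delta> < ?\<sigma>" for \<delta> using that unfolding e_def by simp
  have e2: "e (?\<sigma> + \<gamma>) = h \<gamma>" for \<gamma>
    unfolding e_def using le_add_left[of ?\<sigma> \<gamma>] by (simp only: not_less[symmetric] if_False s)
  have split: "{..<?\<sigma> + \<beta>} = {..<?\<sigma>} \<union> {?\<sigma>..<?\<sigma> + \<beta>}"
    by (rule ivl_disj_un_one(2)[symmetric]) simp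
  have im: "e ` {..<?\<sigma> + \<beta>} = X \<union> Y"
  proof -
    have "e ` {..<?\<sigma>} = X"
      unfolding g(3) by (rule image_cong) (use e1 in auto)
    moreover have "e ` {?\<sigma>..<?\<sigma> + \<beta>} = Y"
      unfolding image_add_lessThan[symmetric] image_image e2 h(3) ..
    ultimately show ?thesis by (simp only: split image_Un)
  qed
  have "strict_mono_on {..<?\<sigma> + \<beta>} e"
  proof (rule strict_mono_onI)
    fix v w assume "v \<in> {..<?\<sigma> + \<beta>}" "w \<in> {..<?\<sigma> + \<beta>}" "v < w"
    then consider "v < ?\<sigma>" "w < ?\<sigma>" | "v < ?\<sigma>" "?\<sigma> \<le> w" "w < ?\<sigma> + \<beta>"
      | "?\<sigma> \<le> v" "?\<sigma> \<le> w" "w < ?\<sigma> + \<beta>"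
      by (metis lessThan_iff not_le le_less_trans less_imp_le order_trans)
    then show "e v < e w"
    proof cases
      case 1
      then show ?thesis using \<open>v < w\<close> by (simp only: e1 strict_mono_onD[OF g(1)] lessThan_iff)
    next
      case 2
      then obtain b where b: "w = ?\<sigma> + b" using le_imp_add by blast
      then have "b < \<beta>" using 2(3) by (simp only: add_less_cancel)
      then have "e v \<in> X" "e w \<in> Y"
        using 2(1) by (simp_all only: e1 b e2 g(3) h(3) lessThan_iff imageI)
      then show ?thesis by (rule XY)
    next
      case 3
      then obtain a b where b: "v = ?\<sigma> + a" "w = ?\<sigma> + b" using le_imp_add by metis
      then have "b < \<beta>" "a < b" using 3(3) \<open>v < w\<close> by (simp_all only: add_less_cancel)
      then show ?thesis
        using strict_mono_onD[OF h(1), of a b] by (simp only: b e2) auto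
    qed
  qed
  moreover have "continuous_on {..<?\<sigma> + \<beta>} e"
  proof -
    have "continuous_on {..<?\<sigma>} e"
      using g(2) e1 by (subst continuous_on_cong[OF refl, of _ e g]) auto
    moreover have "continuous_on {?\<sigma>..<?\<sigma> + \<beta>} e"
    proof -
      have "continuous_on {?\<sigma>..<?\<sigma> + \<beta>} s"
        unfolding image_add_lessThan[symmetric]
        by (rule strict_mono_inverse_continuous) (simp_all add: strict_mono_on_def)
      moreover have "s ` {?\<sigma>..<?\<sigma> + \<beta>} = {..<\<beta>}"
        unfolding image_add_lessThan[symmetric] image_image s by simp
      ultimately have "continuous_on {?\<sigma>..<?\<sigma> + \<beta>} (h \<circ> s)"
        using h(2) by (metis continuous_on_compose)
      then show ?thesis
        by (rule continuous_on_eq) (simp del: less_add_one add: e_def not_less[symmetric])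
    qed
    moreover have "{?\<sigma>..<?\<sigma> + \<beta>} = {\<alpha><..<?\<sigma> + \<beta>}"
      by (auto simp: not_less[symmetric] simp del: not_less)
    ultimately show ?thesis
      unfolding split by (metis continuous_on_open_Un open_lessThan open_greaterThanLessThan)
  qed
  ultimately show ?thesis
    using order_homeomorphic_toI[of "?\<sigma> + \<beta>" e] by (simp only: im)
qed

lemma order_homeomorphic_to_sequence:
  fixes s :: "nat \<Rightarrow> 'a ordinal"
  assumes "strict_mono s" and "s \<longlonglongrightarrow> l"
  shows "order_homeomorphic_to (insert l (range s)) (\<omega> + 1)"
proof -
  define g where "g \<delta> = (if \<delta> < \<omega> then s (inv ord_of_nat \<delta>) else l)" for \<delta> :: "'a ordinal"
  have gn [simp]: "g (ord_of_nat n) = s n" for n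
    by (simp add: g_def inj_ord_of_nat)
  have gw [simp]: "g \<omega> = l" by (simp add: g_def)
  have less: "s n < l" for n
    using incseq_le[of s l "Suc n"] assms strict_mono_less[OF assms(1), of n "Suc n"]
    by (auto intro: less_le_trans strict_mono_mono)
  have cases: "x = \<omega> \<or> (\<exists>n. x = ord_of_nat n)" if "x < \<omega> + 1" for x :: "'a ordinal"
    using that by (auto simp: le_less less_omega_iff)
  have mono: "strict_mono_on {..<\<omega> + 1} g"
  proof (rule strict_mono_onI)
    fix v w :: "'a ordinal"
    assume vw: "v \<in> {..<\<omega> + 1}" "w \<in> {..<\<omega> + 1}" "v < w"
    then have "v < \<omega>" by auto
    then obtain m where m: "v = ord_of_nat m" by (auto simp: less_omega_iff)
    show "g v < g w"
      using cases[of w] vw less strict_mono_less[OF assms(1)] by (auto simp: m)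
  qed
  moreover have "continuous_on {..<\<omega> + 1} g"
    using mono
  proof (rule strict_mono_continuous)
    fix x y :: "'a ordinal"
    assume x: "x < \<omega> + 1" and y: "y < g x"
    consider "x = \<omega>" | "x = 0" | n where "x = ord_of_nat (Suc n)"
      using cases[OF x] by (metis not0_implies_Suc ord_of_nat.simps(1))
    then show "x = 0 \<or> (\<exists>z<x. \<forall>w. z < w \<longrightarrow> w \<le> x \<longrightarrow> y < g w)"
    proof cases
      case 1
      then have "y < l" using y by simp
      then obtain n where n: "y < s n"
        using order_tendstoD(1)[OF assms(2)] by (auto simp: eventually_sequentially)
      have "y < g w" if "ord_of_nat n < w" "w \<le> \<omega>" for w
        using strict_mono_onD[OF mono, of "ord_of_nat n" w] that n
        by (auto simp: less_imp_le intro: less_trans)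
      then show ?thesis using 1 by (intro disjI2 exI[of _ "ord_of_nat n"]) auto
    next
      case 3
      have "w = x" if "ord_of_nat n < w" "w \<le> x" for w
        using that 3 less_add_one[of w "ord_of_nat n"] by (auto simp: le_less simp del: less_add_one)
      then show ?thesis using 3 y by (intro disjI2 exI[of _ "ord_of_nat n"]) auto
    qed simp
  qed
  moreover have "g ` {..<\<omega> + 1} = insert l (range s)"
  proof -
    have "{..<\<omega> + 1} = insert \<omega> (range (ord_of_nat :: nat \<Rightarrow> 'a ordinal))"
      using cases by (auto simp: less_imp_le) blast
    then show ?thesis by (simp add: image_image)
  qed
  ultimately show ?thesis
    using order_homeomorphic_toI[of "\<omega> + 1" g] by simp
qed

section \<open>Colour patterns along a sequence\<close>

text \<open>
  By compactness of \<open>'v \<Rightarrow> bool\<close>, the sequence \<open>f\<close> has a cluster point \<open>h\<close>.  The functions that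
  agree with \<open>h\<close> on a finite set form a neighbourhood of \<open>h\<close>, which the sequence visits infinitely
  often.
\<close>
lemma cluster_pattern:
  fixes f :: "nat \<Rightarrow> 'v \<Rightarrow> bool"
  obtains h where "\<And>F. finite F \<Longrightarrow> infinite {j. \<forall>v\<in>F. f j v = h v}"
proof -
  have "compact_space (product_topology (\<lambda>i :: 'v. euclidean :: bool topology) UNIV)"
    by (subst compact_space_product_topology) (simp add: compact_space_def finite_imp_compact)
  then have "compact (UNIV :: ('v \<Rightarrow> bool) set)"
    by (simp add: euclidean_product_topology compact_space_def)
  moreover have "filtermap f sequentially \<noteq> bot"
    by (simp add: filtermap_bot_iff)
  ultimately obtain h where h: "inf (nhds h) (filtermap f sequentially) \<noteq> bot"
    unfolding compact_filter by force
  show thesis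
  proof (rule that)
    fix F :: "'v set" assume "finite F"
    show "infinite {j. \<forall>v\<in>F. f j v = h v}"
    proof
      assume fin: "finite {j. \<forall>v\<in>F. f j v = h v}"
      have "open (\<Inter>v\<in>F. (\<lambda>g :: 'v \<Rightarrow> bool. g v) -` {h v})"
        using \<open>finite F\<close> by (intro open_INT ballI open_vimage open_discrete continuous_on_product_coordinates) auto
      then have "eventually (\<lambda>g. g \<in> (\<Inter>v\<in>F. (\<lambda>g. g v) -` {h v})) (nhds h)"
        by (rule eventually_nhds_in_open) simp
      moreover have "eventually (\<lambda>g. g \<notin> (\<Inter>v\<in>F. (\<lambda>g. g v) -` {h v})) (filtermap f sequentially)"
        using fin by (simp add: eventually_filtermap eventually_cofinite flip: cofinite_eq_sequentially)
      ultimately have "eventually (\<lambda>g. False) (inf (nhds h) (filtermap f sequentially))"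
        unfolding eventually_inf by blast
      then show False using h by (simp add: trivial_limit_def)
    qed
  qed
qed

section \<open>Partition properties of closed copies\<close>

lemma least_ordinal_holds: "least_ordinal P = Fin \<beta> \<Longrightarrow> P \<beta>"
  by (auto simp: least_ordinal_def split: if_splits intro: LeastI)

lemma least_ordinal_le: "P \<beta> \<Longrightarrow> least_ordinal P \<le> Fin \<beta>"
  by (auto simp: least_ordinal_def intro: Least_le)

lemma least_ordinal_not_Minf: "least_ordinal P \<noteq> -\<infinity>"
  by (simp add: least_ordinal_def)

lemma nsets_imageE:
  assumes "e \<in> nsets (g ` X) n" and "inj_on g X"
  obtains e' where "e' \<in> nsets X n" "e = g ` e'"
proof -
  obtain e' where e': "e' \<subseteq> X" "e = g ` e'"
    using assms(1) by (auto simp: nsets_def subset_image_iff)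
  then have "inj_on g e'" using assms(2) inj_on_subset by blast
  then have "e' \<in> nsets X n"
    using assms(1) e' by (auto simp: nsets_def card_image finite_image_iff)
  with e'(2) that show thesis by blast
qed

text \<open>
  Colourings of the pairs from a closed copy \<open>Z\<close> of \<open>\<rho>\<close> pull back to \<open>\<rho>\<close>, and closed copies in
  \<open>\<rho>\<close> are mapped to closed copies in \<open>Z\<close>.
\<close>
lemma arrow_transfer:
  fixes c :: "'a ordinal set \<Rightarrow> colour"
  assumes Z: "order_homeomorphic_to Z \<rho>"
    and arrow: "\<And>c. (\<exists>X\<subseteq>{..<\<rho>}. order_homeomorphic_to X \<alpha> \<and> (\<forall>e\<in>nsets X 2. c e = Red)) \<or>
      (\<exists>Y\<in>nsets {..<\<rho>} k. \<forall>e\<in>nsets Y 2. c e = Blue)"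
  shows "(\<exists>X\<subseteq>Z. order_homeomorphic_to X \<alpha> \<and> (\<forall>e\<in>nsets X 2. c e = Red)) \<or>
    (\<exists>Y\<in>nsets Z k. \<forall>e\<in>nsets Y 2. c e = Blue)"
proof -
  obtain g where g: "strict_mono_on {..<\<rho>} g" "continuous_on {..<\<rho>} g" "Z = g ` {..<\<rho>}"
    using Z by (auto simp: order_homeomorphic_to_iff)
  have inj: "inj_on g X" if "X \<subseteq> {..<\<rho>}" for X
    using strict_mono_on_imp_inj_on[OF g(1)] that by (rule inj_on_subset)
  have mono: "\<forall>e\<in>nsets (g ` X) 2. c e = b"
    if "X \<subseteq> {..<\<rho>}" "\<forall>e\<in>nsets X 2. c (g ` e) = b" for X b
    using that(2) by (auto elim!: nsets_imageE[OF _ inj[OF that(1)]])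
  consider X where "X \<subseteq> {..<\<rho>}" "order_homeomorphic_to X \<alpha>" "\<forall>e\<in>nsets X 2. c (g ` e) = Red"
    | Y where "Y \<in> nsets {..<\<rho>} k" "\<forall>e\<in>nsets Y 2. c (g ` e) = Blue"
    using arrow[of "\<lambda>e. c (g ` e)"] by blast
  then show ?thesis
  proof cases
    case 1
    have "g ` X \<subseteq> Z" using 1(1) g(3) by blast
    then show ?thesis
      using order_homeomorphic_to_image[OF 1(2,1) g(1,2)] mono[OF 1(1,3)] by blast
  next
    case 2
    have Y: "Y \<subseteq> {..<\<rho>}" using 2(1) by (simp add: nsets_def)
    then have "g ` Y \<in> nsets Z k"
      using 2(1) inj[OF Y] by (auto simp: nsets_def card_image g(3))
    then show ?thesis
      using mono[OF Y 2(2)] by blast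
  qed
qed

lemma Rcl_arrow:
  fixes c :: "'a ordinal set \<Rightarrow> colour"
  assumes "Rcl \<alpha> k = Fin \<rho>" and "order_homeomorphic_to Z \<rho>"
  shows "(\<exists>X\<subseteq>Z. order_homeomorphic_to X \<alpha> \<and> (\<forall>e\<in>nsets X 2. c e = Red)) \<or>
     (\<exists>Y\<in>nsets Z k. \<forall>e\<in>nsets Y 2. c e = Blue)"
  using least_ordinal_holds[OF assms(1)[unfolded Rcl_def]]
  by (intro arrow_transfer[OF assms(2)]) blast

text \<open>
  For finite types, order copies and closed copies are the same.
\<close>
lemma Rord_arrow:
  fixes c :: "'a ordinal set \<Rightarrow> colour"
  assumes "Rord (ord_of_nat n) k = Fin \<rho>" and "order_homeomorphic_to Z \<rho>"
  shows "(\<exists>X\<subseteq>Z. order_homeomorphic_to X (ord_of_nat n) \<and> (\<forall>e\<in>nsets X 2. c e = Red)) \<or>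
     (\<exists>Y\<in>nsets Z k. \<forall>e\<in>nsets Y 2. c e = Blue)"
proof (rule arrow_transfer[OF assms(2)])
  have "order_homeomorphic_to X (ord_of_nat n)"
    if "order_isomorphic_to X (ord_of_nat n)" for X :: "'a ordinal set"
    using that by (rule order_homeomorphic_to_finite) (simp add: lessThan_ord_of_nat)
  then show "(\<exists>X\<subseteq>{..<\<rho>}. order_homeomorphic_to X (ord_of_nat n) \<and> (\<forall>e\<in>nsets X 2. c e = Red)) \<or>
      (\<exists>Y\<in>nsets {..<\<rho>} k. \<forall>e\<in>nsets Y 2. c e = Blue)" for c
    using spec[OF least_ordinal_holds[OF assms(1)[unfolded Rord_def]], of c] by blast
qed

lemma Pcl_arrow:
  assumes "Pcl \<alpha>s = Fin \<pi>" and "order_homeomorphic_to Z \<pi>" and "d \<in> Z \<rightarrow> {..<length \<alpha>s}"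
  obtains i \<alpha> X where "i < length \<alpha>s" "\<alpha>s ! i = Fin \<alpha>" "X \<subseteq> {x \<in> Z. d x = i}" "order_homeomorphic_to X \<alpha>"
proof -
  obtain g where g: "strict_mono_on {..<\<pi>} g" "continuous_on {..<\<pi>} g" "Z = g ` {..<\<pi>}"
    using assms(2) by (auto simp: order_homeomorphic_to_iff)
  have "d \<circ> g \<in> {..<\<pi>} \<rightarrow> {..<length \<alpha>s}"
    using assms(3) g(3) by auto
  then obtain i \<alpha> X where X: "i < length \<alpha>s" "\<alpha>s ! i = Fin \<alpha>"
      "X \<subseteq> {x \<in> {..<\<pi>}. (d \<circ> g) x = i}" "order_homeomorphic_to X \<alpha>"
    using least_ordinal_holds[OF assms(1)[unfolded Pcl_def]] by blast
  then have "X \<subseteq> {..<\<pi>}" "g ` X \<subseteq> {x \<in> Z. d x = i}"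
    using g(3) by auto
  then show thesis
    using that[OF X(1,2)] order_homeomorphic_to_image[OF X(4) _ g(1,2)] by blast
qed

section \<open>Monochromatic sets\<close>

lemma blue_extension:
  assumes Y: "Y \<in> nsets A k" "\<forall>e\<in>nsets Y 2. c e = Blue"
    and x: "x \<notin> A" "\<forall>v\<in>Y. c {x, v} = Blue"
  shows "insert x Y \<in> nsets (insert x A) (k + 1)" "\<forall>e\<in>nsets (insert x Y) 2. c e = Blue"
proof -
  have "x \<notin> Y" using Y(1) x(1) by (auto simp: nsets_def)
  then show "insert x Y \<in> nsets (insert x A) (k + 1)"
    using Y(1) by (auto simp: nsets_def)
  show "\<forall>e\<in>nsets (insert x Y) 2. c e = Blue"
  proof
    fix e assume "e \<in> nsets (insert x Y) 2"
    then obtain u v where "e = {u, v}" "u \<in> insert x Y" "v \<in> insert x Y" "u \<noteq> v"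
      by (auto elim: nsets2_E)
    then show "c e = Blue"
      using x(2) Y(2) by (auto simp: insert_commute)
  qed
qed

lemma red_Un:
  assumes "\<forall>e\<in>nsets X 2. c e = Red" "\<forall>e\<in>nsets Y 2. c e = Red"
    and "\<And>x v. x \<in> X \<Longrightarrow> v \<in> Y \<Longrightarrow> c {x, v} = Red"
  shows "\<forall>e\<in>nsets (X \<union> Y) 2. c e = Red"
proof
  fix e assume "e \<in> nsets (X \<union> Y) 2"
  then obtain u v where "e = {u, v}" "u \<in> X \<union> Y" "v \<in> X \<union> Y" "u \<noteq> v"
    by (auto elim: nsets2_E)
  then show "c e = Red"
    using assms assms(3)[of v u] by (auto simp: insert_commute)
qed

section \<open>Thinning a copy of \<open>\<omega> * m + 1\<close>\<close>

lemma omega_times_Suc: "\<omega> * ord_of_nat (Suc i) = \<omega> * ord_of_nat i + (\<omega> :: 'a ordinal)"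
  by (simp add: times_add_one)

lemma block_index_le:
  assumes "i < m"
  shows "\<omega> * ord_of_nat i + ord_of_nat j \<le> (\<omega> * ord_of_nat m :: 'a ordinal)"
proof -
  have "\<omega> * ord_of_nat i + ord_of_nat j \<le> \<omega> * ord_of_nat i + (\<omega> :: 'a ordinal)"
    by (simp add: less_imp_le)
  also have "\<dots> \<le> \<omega> * ord_of_nat m"
    using assms by (simp only: omega_times_Suc[symmetric] times_mono_right ord_of_nat_le_iff Suc_leI)
  finally show ?thesis .
qed

text \<open>
  A subsequence has the same limit, so the members of a convergent sequence with property \<open>P\<close>
  and the limit form a closed copy of \<open>\<omega> + 1\<close>.  The sequence starts after \<open>g \<alpha>\<close>: when
  blocks are joined, this point can be the limit of the preceding block, and blocks must not
  overlap.
\<close>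
lemma thin_block:
  fixes g :: "'a ordinal \<Rightarrow> 'a ordinal"
  assumes g: "strict_mono_on {..<\<beta>} g" "continuous_on {..<\<beta>} g"
    and lim: "\<alpha> + \<omega> < \<beta>" "P (g (\<alpha> + \<omega>))"
    and inf: "infinite {j. P (g (\<alpha> + ord_of_nat (Suc j)))}"
  obtains B where "B \<subseteq> g ` {\<alpha><..\<alpha> + \<omega>}" "\<forall>x\<in>B. P x" "order_homeomorphic_to B (\<omega> + 1)"
proof -
  let ?J = "{j. P (g (\<alpha> + ord_of_nat (Suc j)))}"
  let ?s = "\<lambda>j. g (\<alpha> + ord_of_nat (Suc j))"
  let ?r = "enumerate ?J"
  have r: "strict_mono ?r" using inf by (rule strict_mono_enumerate)
  have below: "\<alpha> + ord_of_nat j < \<alpha> + \<omega>" for j by simp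
  then have below': "\<alpha> + ord_of_nat j < \<beta>" for j using lim(1) by (rule less_trans)
  have "?s \<longlonglongrightarrow> g (\<alpha> + \<omega>)"
    by (rule continuous_on_tendsto_compose[OF g(2) LIMSEQ_Suc[OF tendsto_add_omega]])
      (use lim(1) below' in \<open>simp_all del: ord_of_nat.simps\<close>)
  then have "(?s \<circ> ?r) \<longlonglongrightarrow> g (\<alpha> + \<omega>)"
    using r by (rule LIMSEQ_subseq_LIMSEQ)
  moreover have "strict_mono ?s"
    using below' by (intro strict_monoI strict_mono_onD[OF g(1)]) (simp_all del: ord_of_nat.simps)
  then have "strict_mono (?s \<circ> ?r)" using r by (rule strict_mono_o)
  ultimately have "order_homeomorphic_to (insert (g (\<alpha> + \<omega>)) (range (?s \<circ> ?r))) (\<omega> + 1)"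
    by (intro order_homeomorphic_to_sequence)
  moreover have "?s j \<in> g ` {\<alpha><..\<alpha> + \<omega>}" for j
  proof -
    have "ord_of_nat 0 < (ord_of_nat (Suc j) :: 'a ordinal)" by (simp only: ord_of_nat_less_iff)
    then have "\<alpha> + 0 < \<alpha> + ord_of_nat (Suc j)" by (simp only: add_less_cancel ord_of_nat.simps(1))
    then show ?thesis
      using below[of "Suc j"]
      by (intro imageI) (simp add: less_imp_le del: add_less_cancel ord_of_nat.simps)
  qed
  moreover have "g (\<alpha> + \<omega>) \<in> g ` {\<alpha><..\<alpha> + \<omega>}"
    using below[of 0] by (intro imageI) auto
  moreover have "P ((?s \<circ> ?r) j)" for j
    using enumerate_in_set[OF inf] by auto
  ultimately show thesis
    using lim(2) by (intro that[of "insert (g (\<alpha> + \<omega>)) (range (?s \<circ> ?r))"]) auto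
qed

text \<open>
  Induction on the number of blocks.  Each step appends a copy of \<open>\<omega> + 1\<close> to a copy of
  \<open>\<omega> * i + 1\<close>, which gives the right type since \<open>1 + \<omega> = \<omega>\<close> absorbs the extra point.
\<close>
lemma thin_copy:
  fixes g :: "'a ordinal \<Rightarrow> 'a ordinal"
  assumes g: "strict_mono_on {..<\<omega> * ord_of_nat m + 1} g" "continuous_on {..<\<omega> * ord_of_nat m + 1} g"
    and lim: "\<And>i. i < m \<Longrightarrow> P (g (\<omega> * ord_of_nat (Suc i)))"
    and inf: "\<And>i. i < m \<Longrightarrow> infinite {j. P (g (\<omega> * ord_of_nat i + ord_of_nat (Suc j)))}"
    and "m \<ge> 1"
  obtains X where "X \<subseteq> g ` {..<\<omega> * ord_of_nat m + 1}" "\<forall>x\<in>X. P x"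
    "order_homeomorphic_to X (\<omega> * ord_of_nat m + 1)"
proof -
  have block: "\<exists>B. B \<subseteq> g ` {\<omega> * ord_of_nat i<..\<omega> * ord_of_nat (Suc i)} \<and> (\<forall>x\<in>B. P x) \<and>
      order_homeomorphic_to B (\<omega> + 1)" if "i < m" for i
  proof -
    have "\<omega> * ord_of_nat i + \<omega> < \<omega> * ord_of_nat m + (1 :: 'a ordinal)"
      using times_mono_right[of "ord_of_nat (Suc i)" "ord_of_nat m" "\<omega> :: 'a ordinal"] Suc_leI[OF that]
      by (simp only: omega_times_Suc[symmetric] less_add_one ord_of_nat_le_iff)
    from thin_block[OF g this lim[OF that, unfolded omega_times_Suc] inf[OF that]]
    show ?thesis unfolding omega_times_Suc by metis
  qed
  have "\<exists>X. X \<subseteq> g ` {..\<omega> * ord_of_nat i} \<and> (\<forall>x\<in>X. P x) \<and>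
      order_homeomorphic_to X (\<omega> * ord_of_nat i + 1)" if "1 \<le> i" "i \<le> m" for i
    using that
  proof (induction i rule: nat_induct_at_least)
    case base
    obtain B where "B \<subseteq> g ` {\<omega> * ord_of_nat 0<..\<omega> * ord_of_nat (Suc 0)}" "\<forall>x\<in>B. P x"
        "order_homeomorphic_to B (\<omega> + 1)"
      using block[of 0] base by auto
    moreover have "0 + \<omega> = (\<omega> :: 'a ordinal)"
      by (metis ordinal_add_assoc add_zero one_add_omega one_add_ord_of_nat ord_of_nat.simps(1))
    ultimately show ?case
      by (intro exI[of _ B]) (auto simp: times_add_one)
  next
    case (Suc i)
    then obtain X where X: "X \<subseteq> g ` {..\<omega> * ord_of_nat i}" "\<forall>x\<in>X. P x"
        "order_homeomorphic_to X (\<omega> * ord_of_nat i + 1)"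
      by auto
    obtain B where B: "B \<subseteq> g ` {\<omega> * ord_of_nat i<..\<omega> * ord_of_nat (Suc i)}" "\<forall>x\<in>B. P x"
        "order_homeomorphic_to B (\<omega> + 1)"
      using block[of i] Suc.prems by auto
    have le: "\<omega> * ord_of_nat (Suc i) \<le> (\<omega> * ord_of_nat m :: 'a ordinal)"
      using Suc.prems by (simp only: times_mono_right ord_of_nat_le_iff)
    have "order_homeomorphic_to (X \<union> B) (\<omega> * ord_of_nat i + 1 + (\<omega> + 1))"
    proof (rule order_homeomorphic_to_Un[OF X(3) B(3)])
      fix x y assume "x \<in> X" "y \<in> B"
      then have "x \<in> g ` {..\<omega> * ord_of_nat i}" "y \<in> g ` {\<omega> * ord_of_nat i<..\<omega> * ord_of_nat (Suc i)}"
        using X(1) B(1) by (meson subsetD)+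
      then obtain u v where uv: "x = g u" "y = g v" "u \<le> \<omega> * ord_of_nat i"
          "\<omega> * ord_of_nat i < v" "v \<le> \<omega> * ord_of_nat (Suc i)"
        unfolding image_iff Bex_def atMost_iff greaterThanAtMost_iff by (elim exE conjE) (rule that)
      then have "u < v" "v \<le> \<omega> * ord_of_nat m"
        using le by (blast intro: le_less_trans order_trans)+
      then show "x < y"
        unfolding uv(1,2) by (intro strict_mono_onD[OF g(1)]) auto
    qed
    also have "\<omega> * ord_of_nat i + 1 + (\<omega> + 1) = \<omega> * ord_of_nat (Suc i) + (1 :: 'a ordinal)"
      by (metis ordinal_add_assoc one_add_omega omega_times_Suc)
    finally have "order_homeomorphic_to (X \<union> B) (\<omega> * ord_of_nat (Suc i) + 1)" .
    moreover have "\<omega> * ord_of_nat i \<le> (\<omega> * ord_of_nat (Suc i) :: 'a ordinal)"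
      by (simp only: times_mono_right ord_of_nat_le_iff)
    then have "X \<union> B \<subseteq> g ` {..\<omega> * ord_of_nat (Suc i)}"
      using X(1) B(1) by (fastforce simp del: ord_of_nat.simps)
    ultimately show ?case
      using X(2) B(2) by blast
  qed
  from this[of m] show thesis
    using \<open>m \<ge> 1\<close> that by (auto simp: lessThan_def atMost_def)
qed

section \<open>The recursive bound\<close>

theorem proposition5p5:
  fixes k m n :: nat
  assumes "k \<ge> 2" and "m \<ge> 1" and "n \<ge> 1"
  shows "Rcl (\<omega> * ord_of_nat m + ord_of_nat n + 1 :: 'a ordinal) (k + 1)
    \<le> Rcl (\<omega> * ord_of_nat m + 1) (k + 1)
      + Pcl (replicate (2 * m) (Rcl (\<omega> * ord_of_nat m + ord_of_nat n + 1) k)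
             @ [Rord (ord_of_nat n) (k + 1)])"
proof -
  define W :: "'a ordinal" where "W = \<omega> * ord_of_nat m"
  define \<alpha> where "\<alpha> = W + ord_of_nat n + 1"
  define \<alpha>s where "\<alpha>s = replicate (2 * m) (Rcl \<alpha> k) @ [Rord (ord_of_nat n) (k + 1)]"
  have "Rcl \<alpha> (k + 1) \<le> Rcl (W + 1) (k + 1) + Pcl \<alpha>s"
  proof (cases "\<exists>\<gamma> \<pi>. Rcl (W + 1) (k + 1) = Fin \<gamma> \<and> Pcl \<alpha>s = Fin \<pi>")
    case False
    have not_Minf: "Rcl (W + 1) (k + 1) \<noteq> -\<infinity>" "Pcl \<alpha>s \<noteq> -\<infinity>"
      unfolding Rcl_def Pcl_def by (rule least_ordinal_not_Minf)+
    from False not_Minf have "Rcl (W + 1) (k + 1) + Pcl \<alpha>s = \<infinity>"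
      by (metis extended.exhaust plus_extended.simps(2) plus_extended.simps(3) plus_extended.simps(4))
    then show ?thesis by simp
  next
    case True
    then obtain \<gamma> \<pi> where \<gamma>: "Rcl (W + 1) (k + 1) = Fin \<gamma>" and \<pi>: "Pcl \<alpha>s = Fin \<pi>"
      by blast
    have "(\<exists>X\<subseteq>{..<\<gamma> + \<pi>}. order_homeomorphic_to X \<alpha> \<and> (\<forall>e\<in>nsets X 2. c e = Red)) \<or>
        (\<exists>Y\<in>nsets {..<\<gamma> + \<pi>} (k + 1). \<forall>e\<in>nsets Y 2. c e = Blue)" (is "?red \<or> ?blue") for c
    proof (rule disjCI)
      assume no_blue: "\<not> ?blue"
      have sub: "{..<\<gamma>} \<subseteq> {..<\<gamma> + \<pi>}" "{\<gamma>..<\<gamma> + \<pi>} \<subseteq> {..<\<gamma> + \<pi>}"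
        using le_add_left[of \<gamma> \<pi>] by (auto intro: less_le_trans)
      obtain X where X: "X \<subseteq> {..<\<gamma>}" "order_homeomorphic_to X (W + 1)" "\<forall>e\<in>nsets X 2. c e = Red"
        using Rcl_arrow[OF \<gamma> order_homeomorphic_to_lessThan, of c] no_blue nsets_mono[OF sub(1)] by blast
      obtain g where g: "strict_mono_on {..<W + 1} g" "continuous_on {..<W + 1} g" "X = g ` {..<W + 1}"
        using X(2) by (auto simp only: order_homeomorphic_to_iff)
      \<comment> \<open>Positions \<open>q < m\<close> are the sequences; positions \<open>m \<le> q\<close> are the limits, as constant sequences.\<close>
      define t where "t q j = (if q < m then g (\<omega> * ord_of_nat q + ord_of_nat (Suc j))
        else g (\<omega> * ord_of_nat (Suc (q - m))))" for q j
      have tX: "t q j \<in> X" if "q < 2 * m" for q j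
      proof (cases "q < m")
        case True
        then show ?thesis
          using block_index_le[of q m "Suc j", where 'a = 'a]
          by (simp add: t_def g(3) W_def del: ord_of_nat.simps)
      next
        case False
        then have "\<omega> * ord_of_nat (Suc (q - m)) \<le> W"
          using that unfolding W_def by (intro times_mono_right) (simp del: ord_of_nat.simps)
        then show ?thesis
          using False by (simp add: t_def g(3) del: ord_of_nat.simps)
      qed
      have "\<exists>h. \<forall>F. finite F \<longrightarrow> infinite {j. \<forall>v\<in>F. (c {t q j, v} = Blue) = h v}" for q
        by (rule cluster_pattern[of "\<lambda>j v. c {t q j, v} = Blue"]) blast
      then have "\<exists>h. \<forall>q F. finite F \<longrightarrow> infinite {j. \<forall>v\<in>F. (c {t q j, v} = Blue) = h q v}"
        by (intro choice allI)
      then obtain h where h: "infinite {j. \<forall>v\<in>F. (c {t q j, v} = Blue) = h q v}" if "finite F" for q F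
        by blast
      \<comment> \<open>The vertex \<open>v\<close> is blue to the object \<open>q\<close> when \<open>h q v\<close> holds.\<close>
      define d where "d v = (if \<exists>q<2 * m. h q v then LEAST q. h q v else 2 * m)" for v
      have d_less: "h (d v) v" if "d v < 2 * m" for v
        using that by (auto simp: d_def intro: LeastI split: if_splits)
      have d_eq: "\<not> h q v" if "d v = 2 * m" "q < 2 * m" for v q
        using that by (auto simp: d_def split: if_splits dest: Least_le[of "\<lambda>q. h q v"])
      have "d v \<le> 2 * m" for v
        by (auto simp: d_def intro: order_trans[OF Least_le])
      then have "d \<in> {\<gamma>..<\<gamma> + \<pi>} \<rightarrow> {..<length \<alpha>s}"
        by (auto simp: \<alpha>s_def less_Suc_eq_le)
      then obtain i \<rho> A where i: "i < length \<alpha>s" "\<alpha>s ! i = Fin \<rho>"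
          "A \<subseteq> {x \<in> {\<gamma>..<\<gamma> + \<pi>}. d x = i}" "order_homeomorphic_to A \<rho>"
        using Pcl_arrow[OF \<pi> order_homeomorphic_to_interval] by blast
      have A: "A \<subseteq> {\<gamma>..<\<gamma> + \<pi>}" "A \<subseteq> {..<\<gamma> + \<pi>}" using i(3) sub(2) by auto
      consider "i < 2 * m" | "i = 2 * m" using i(1) by (force simp: \<alpha>s_def)
      then show ?red
      proof cases
        case 1
        then have "Rcl \<alpha> k = Fin \<rho>"
          using i(2) by (simp add: \<alpha>s_def nth_append)
        from Rcl_arrow[OF this i(4), of c] show ?red
        proof
          assume "\<exists>X\<subseteq>A. order_homeomorphic_to X \<alpha> \<and> (\<forall>e\<in>nsets X 2. c e = Red)"
          then show ?red using A(2) by blast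
        next
          assume "\<exists>Y\<in>nsets A k. \<forall>e\<in>nsets Y 2. c e = Blue"
          then obtain Y where Y: "Y \<in> nsets A k" "\<forall>e\<in>nsets Y 2. c e = Blue" by blast
          then have "finite Y" "Y \<subseteq> A" by (auto simp: nsets_def)
          obtain j where j: "\<forall>v\<in>Y. (c {t i j, v} = Blue) = h i v"
            using not_finite_existsD[OF h[OF \<open>finite Y\<close>]] by blast
          have "h i v" if "v \<in> Y" for v
            using that \<open>Y \<subseteq> A\<close> i(3) d_less[of v] 1 by auto
          with j have blue: "\<forall>v\<in>Y. c {t i j, v} = Blue" by blast
          have "t i j < \<gamma>" using tX[OF 1] X(1) by auto
          then have new: "t i j \<notin> A" "insert (t i j) A \<subseteq> {..<\<gamma> + \<pi>}"
            using A sub(1) by (meson atLeastLessThan_iff not_le subsetD, meson insert_subset lessThan_iff subsetD)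
          show ?red
            using blue_extension[OF Y new(1) blue] nsets_mono[OF new(2)] no_blue by blast
        qed
      next
        case 2
        then have "Rord (ord_of_nat n) (k + 1) = Fin \<rho>"
          using i(2) by (simp add: \<alpha>s_def nth_append)
        from Rord_arrow[OF this i(4), of c]
        obtain Y where Y: "Y \<subseteq> A" "order_homeomorphic_to Y (ord_of_nat n)" "\<forall>e\<in>nsets Y 2. c e = Red"
          using no_blue nsets_mono[OF A(2)] by blast
        have "finite Y"
          using Y(2) by (auto simp: order_homeomorphic_to_iff lessThan_ord_of_nat)
        define P where "P x \<longleftrightarrow> (\<forall>v\<in>Y. c {x, v} = Red)" for x
        have no: "\<not> h q v" if "v \<in> Y" "q < 2 * m" for v q
          using d_eq that Y(1) i(3) 2 by auto
        have inf: "infinite {j. P (t q j)}" if "q < 2 * m" for q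
        proof -
          have "{j. P (t q j)} = {j. \<forall>v\<in>Y. (c {t q j, v} = Blue) = h q v}"
            using no that by (auto simp: P_def) (metis colour.exhaust colour.distinct(1))+
          then show ?thesis using h[OF \<open>finite Y\<close>] by simp
        qed
        \<comment> \<open>For a constant sequence, one occurrence of \<open>P\<close> is enough.\<close>
        have "P (g (\<omega> * ord_of_nat (Suc q)))" if "q < m" for q
          using not_finite_existsD[OF inf[of "q + m"]] that by (auto simp: t_def)
        moreover have "infinite {j. P (g (\<omega> * ord_of_nat q + ord_of_nat (Suc j)))}" if "q < m" for q
          using inf[of q] that by (simp add: t_def)
        ultimately obtain X' where X': "X' \<subseteq> X" "\<forall>x\<in>X'. P x" "order_homeomorphic_to X' (W + 1)"
          using thin_copy[OF g(1,2)[unfolded W_def], of P] \<open>m \<ge> 1\<close> unfolding g(3) W_def by metis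
        have "order_homeomorphic_to (X' \<union> Y) (W + 1 + ord_of_nat n)"
        proof (rule order_homeomorphic_to_Un[OF X'(3) Y(2)])
          fix x y assume "x \<in> X'" "y \<in> Y"
          then have "x < \<gamma>" "\<gamma> \<le> y" using X' X(1) Y(1) A(1) by auto
          then show "x < y" by simp
        qed
        moreover have "W + 1 + ord_of_nat n = \<alpha>"
          by (simp add: \<alpha>_def ordinal_add_assoc one_add_ord_of_nat)
        moreover have "\<forall>e\<in>nsets (X' \<union> Y) 2. c e = Red"
          using X(3) nsets_mono[OF X'(1)] Y(3) X'(2) by (intro red_Un) (auto simp: P_def)
        moreover have "X' \<union> Y \<subseteq> {..<\<gamma> + \<pi>}"
          using subset_trans[OF X'(1) subset_trans[OF X(1) sub(1)]] subset_trans[OF Y(1) A(2)]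
          by (rule Un_least)
        ultimately show ?red by metis
      qed
    qed
    then have "Rcl \<alpha> (k + 1) \<le> Fin (\<gamma> + \<pi>)"
      unfolding Rcl_def by (intro least_ordinal_le) blast
    then show ?thesis by (simp only: \<gamma> \<pi> plus_extended.simps)
  qed
  then show ?thesis
    unfolding \<alpha>s_def \<alpha>_def W_def .
qed

end
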